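(* Let $\{a_n\}_{n\in\mathbb{Z}}$, $\{b_n\}_{n\in\mathbb{Z}}$, $\{s_n\}_{n\in\mathbb{Z}}$, $\{m_n\}_{n\in\mathbb{Z}}$ be sequences of complex numbers such that $a_n\neq 0$ and $b_n\neq 0$ for all $n$, and the $s_n$ are pairwise distinct. Let $F=(F(n,k))_{n,k\in\mathbb{Z}}$ and $G=(G(n,k))_{n,k\in\mathbb{Z}}$ be the lower-triangular matrices ($F(n,k)=G(n,k)=0$ for $n<k$) whose entries for $n\ge k$ are $$F(n,k)=\frac{b_n}{b_k}\prod_{i=k+1}^{n}\frac{m_i\,(s_k-s_{i-1}+a_{i-1}b_{i-1}m_{i-1})}{s_k-s_i},\qquad G(n,k)=\frac{a_k}{a_n}\prod_{i=k}^{n-1}\frac{m_i\,(s_n-s_{i+1}+a_{i+1}b_{i+1}m_{i+1})}{s_n-s_i}.$$ Then $F$ and $G$ form a matrix inversion, i.e. $\sum_{k\le i\le n}F(n,i)G(i,k)=\delta_{n,k}$ for all integers $n,k$.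
   Context: Empty products (upper limit one less than the lower limit) equal $1$. $\delta_{n,k}$ is the Kronecker delta. Two lower-triangular matrices $F,G$ indexed by $\mathbb{Z}$ form a "matrix inversion" if $\sum_{k\le i\le n}F(n,i)G(i,k)=\delta_{n,k}$ for all $n,k\in\mathbb{Z}$. *)

theory Defs
  imports Complex_Main
begin

text \<open>A matrix indexed by the integers is a function of its row and column index.\<close>

definition lower_triangular :: "(int \<Rightarrow> int \<Rightarrow> complex) \<Rightarrow> bool" where
  "lower_triangular A \<longleftrightarrow> (\<forall>n k. n < k \<longrightarrow> A n k = 0)"

definition matrix_inversion ::
  "(int \<Rightarrow> int \<Rightarrow> complex) \<Rightarrow> (int \<Rightarrow> int \<Rightarrow> complex) \<Rightarrow> bool" where
  "matrix_inversion F G \<longleftrightarrow>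
     lower_triangular F \<and> lower_triangular G \<and>
     (\<forall>n k. (\<Sum>i\<in>{k..n}. F n i * G i k) = (if n = k then 1 else 0))"

end

theory Submission
  imports Defs "HOL-Computational_Algebra.Polynomial"
begin

text \<open>
  Put \<open>c i = a i * b i * m i\<close>. For \<open>k < n\<close> the product \<open>F n i * G i k\<close> equals, up to a factor
  independent of \<open>i\<close>, the value at \<open>s i\<close> of the polynomial
  \<open>\<Prod>j=k+1..n-1. (x - s j + c j)\<close> divided by \<open>\<Prod>j\<noteq>i. (s i - s j)\<close>. The sum over \<open>i\<close> is thus a divided
  difference of a polynomial of degree \<open>n - k - 1\<close> at \<open>n - k + 1\<close> nodes, which vanishes.
\<close>

text \<open>Lagrange interpolation at the nodes \<open>s i\<close> reproduces \<open>p\<close>,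
  whose degree is below \<open>card A\<close>. The sum is the coefficient of degree
  \<open>card A - 1\<close> of the interpolant, and \<open>degree p\<close> is smaller than
  that.\<close>

lemma divided_difference_eq_0:
  fixes p :: "'a :: field poly"
  assumes "finite A" "inj_on s A" "degree p + 1 < card A"
  shows "(\<Sum>i\<in>A. poly p (s i) / (\<Prod>j\<in>A - {i}. s i - s j)) = 0"
proof -
  \<comment> \<open>\<open>B i\<close> is the Lagrange basis polynomial without its normalising
    constant, which sits in \<open>w i\<close>; \<open>L\<close> is the interpolant of
    \<open>p\<close>.\<close>
  define w where "w i = poly p (s i) / (\<Prod>j\<in>A - {i}. s i - s j)" for i
  define B where "B i = (\<Prod>j\<in>A - {i}. [:- s j, 1:])" for i
  define L where "L = (\<Sum>i\<in>A. smult (w i) (B i))"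
  have degB: "degree (B i) = card A - 1" if "i \<in> A" for i
    using that assms(1) unfolding B_def by (subst degree_prod_sum_eq) auto
  have monic: "coeff (B i) (card A - 1) = 1" if "i \<in> A" for i
  proof -
    have "lead_coeff (B i) = 1"
      unfolding B_def by (simp add: lead_coeff_prod)
    with degB[OF that] show ?thesis by simp
  qed
  have "poly L x = poly p x" if x: "x \<in> s ` A" for x
  proof -
    from x obtain i where i: "i \<in> A" "x = s i" by blast
    have nz: "(\<Prod>j\<in>A - {i}. s i - s j) \<noteq> 0"
      using i assms(1,2) by (auto simp: inj_on_def)
    have "poly (B l) (s i) = 0" if "l \<in> A - {i}" for l
      using that i assms(1) by (auto simp: B_def poly_prod)
    then have "poly L x = w i * poly (B i) (s i)"
      using i assms(1) by (simp add: L_def poly_sum sum.remove[of A i])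
    also have "poly (B i) (s i) = (\<Prod>j\<in>A - {i}. s i - s j)"
      by (simp add: B_def poly_prod)
    finally show ?thesis
      using nz i by (simp add: w_def)
  qed
  moreover have "degree L < card A"
    unfolding L_def
  proof (rule degree_sum_less)
    show "degree (smult (w i) (B i)) < card A" if "i \<in> A" for i
      using degB[OF that] degree_smult_le[of "w i" "B i"] assms(3) by linarith
  qed (use assms(3) in simp)
  ultimately have "L = p"
    using assms by (intro poly_eqI_degree[of "s ` A"]) (auto simp: card_image)
  \<comment> \<open>Every \<open>B i\<close> is monic of degree \<open>card A - 1\<close>, so each
    term adds exactly \<open>w i\<close> to this coefficient.\<close>
  have "(\<Sum>i\<in>A. w i) = coeff L (card A - 1)"
    by (simp add: L_def coeff_sum monic del: One_nat_def)
  also have "\<dots> = 0"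
    using \<open>L = p\<close> assms(3) by (intro coeff_eq_0) simp
  finally show ?thesis
    by (simp add: w_def)
qed

lemma prod_int_shift_down:
  "(\<Prod>i\<in>{k + 1..n}. f (i - 1)) = (\<Prod>i\<in>{k..n - 1::int}. f i)"
  by (rule prod.reindex_bij_witness[of _ "\<lambda>i. i + 1" "\<lambda>i. i - 1"]) auto

lemma prod_int_shift_up:
  "(\<Prod>i\<in>{k..n - 1}. f (i + 1)) = (\<Prod>i\<in>{k + 1..n::int}. f i)"
  by (rule prod.reindex_bij_witness[of _ "\<lambda>i. i - 1" "\<lambda>i. i + 1"]) auto

text \<open>Joins the ranges coming from \<open>F n i\<close> and \<open>G i k\<close>; with it the
  denominators become the product over all nodes other than \<open>i\<close>.\<close>

lemma prod_int_remove:
  fixes f :: "int \<Rightarrow> 'a :: comm_monoid_mult"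
  assumes "k \<le> i" "i \<le> n"
  shows "(\<Prod>j\<in>{i + 1..n}. f j) * (\<Prod>j\<in>{k..i - 1}. f j) = (\<Prod>j\<in>{k..n} - {i}. f j)"
proof -
  have "{k..n} - {i} = {i + 1..n} \<union> {k..i - 1}"
    using assms by auto
  then show ?thesis
    by (simp add: prod.union_disjoint)
qed

text \<open>For \<open>k < i < n\<close> the two ranges cover \<open>{k + 1..n - 1}\<close> and
  share only \<open>i\<close>. For \<open>i = k\<close> or \<open>i = n\<close> one range is empty
  and the other adds \<open>i\<close> from outside. Either way there is one surplus factor
  \<open>f i\<close>.\<close>

lemma prod_int_overlap:
  fixes f :: "int \<Rightarrow> 'a :: comm_monoid_mult"
  assumes "k \<le> i" "i \<le> n" "k < n"
  shows "(\<Prod>j\<in>{i..n - 1}. f j) * (\<Prod>j\<in>{k + 1..i}. f j) = f i * (\<Prod>j\<in>{k + 1..n - 1}. f j)"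
proof (cases "i = n")
  case True
  with assms have "{k + 1..i} = insert i {k + 1..n - 1}" by auto
  with True show ?thesis by simp
next
  case False
  with assms have "{i..n - 1} = insert i {i + 1..n - 1}" by auto
  moreover have "{k + 1..n - 1} = {i + 1..n - 1} \<union> {k + 1..i}"
    using assms False by auto
  ultimately show ?thesis
    by (simp add: prod.union_disjoint ac_simps)
qed

theorem theorem1p3:
  fixes a b s m :: "int \<Rightarrow> complex"
    and F G :: "int \<Rightarrow> int \<Rightarrow> complex"
  assumes "\<And>n. a n \<noteq> 0"
    and "\<And>n. b n \<noteq> 0"
    and "inj s"
    and "\<And>n k. n < k \<Longrightarrow> F n k = 0"
    and "\<And>n k. k \<le> n \<Longrightarrow>
      F n k = b n / b k *
        (\<Prod>i\<in>{k + 1..n}. m i * (s k - s (i - 1) + a (i - 1) * b (i - 1) * m (i - 1))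
                            / (s k - s i))"
    and "\<And>n k. n < k \<Longrightarrow> G n k = 0"
    and "\<And>n k. k \<le> n \<Longrightarrow>
      G n k = a k / a n *
        (\<Prod>i\<in>{k..n - 1}. m i * (s n - s (i + 1) + a (i + 1) * b (i + 1) * m (i + 1))
                            / (s n - s i))"
  shows "matrix_inversion F G"
proof -
  define c where "c i = a i * b i * m i" for i
  \<comment> \<open>The shift makes the numerators \<open>s k - s i + c i\<close>, of the same shape
    as those of \<open>G\<close>, at the price of a range different from that of the
    denominators.\<close>
  have F: "F n k = b n / b k * ((\<Prod>i\<in>{k + 1..n}. m i) * (\<Prod>i\<in>{k..n - 1}. s k - s i + c i)
             / (\<Prod>i\<in>{k + 1..n}. s k - s i))" if "k \<le> n" for n k
    using assms(5)[OF that] prod_int_shift_down[of "\<lambda>i. s k - s i + c i" k n]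
    by (simp add: prod.distrib prod_dividef c_def)
  have G: "G n k = a k / a n * ((\<Prod>i\<in>{k..n - 1}. m i) * (\<Prod>i\<in>{k + 1..n}. s n - s i + c i)
             / (\<Prod>i\<in>{k..n - 1}. s n - s i))" if "k \<le> n" for n k
    using assms(7)[OF that] prod_int_shift_up[of "\<lambda>i. s n - s i + c i" k n]
    by (simp add: prod.distrib prod_dividef c_def)
  have off_diag: "(\<Sum>i\<in>{k..n}. F n i * G i k) = 0" if "k < n" for n k
  proof -
    define p where "p = (\<Prod>j\<in>{k + 1..n - 1}. [:c j - s j, 1:])"
    have deg: "degree p = nat (n - 1 - k)"
      unfolding p_def by (subst degree_prod_sum_eq) auto
    have "F n i * G i k = b n * a k * (\<Prod>j\<in>{k..n}. m j)
            * (poly p (s i) / (\<Prod>j\<in>{k..n} - {i}. s i - s j))" if i: "i \<in> {k..n}" for i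
    proof -
      have ki: "k \<le> i" and "i \<le> n"
        using i by auto
      have "F n i * G i k = b n / b i * (a k / a i)
          * ((\<Prod>j\<in>{i + 1..n}. m j) * (\<Prod>j\<in>{k..i - 1}. m j))
          * (((\<Prod>j\<in>{i..n - 1}. s i - s j + c j) * (\<Prod>j\<in>{k + 1..i}. s i - s j + c j))
          / ((\<Prod>j\<in>{i + 1..n}. s i - s j) * (\<Prod>j\<in>{k..i - 1}. s i - s j)))"
        by (simp add: F[OF \<open>i \<le> n\<close>] G[OF ki] ac_simps)
      \<comment> \<open>The surplus numerator factor is the one at \<open>j = i\<close>, where
        \<open>s i - s j + c j\<close> collapses to \<open>c i\<close>.\<close>
      also have "\<dots> = b n / b i * (a k / a i) * (\<Prod>j\<in>{k..n} - {i}. m j)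
          * ((c i * (\<Prod>j\<in>{k + 1..n - 1}. s i - s j + c j)) / (\<Prod>j\<in>{k..n} - {i}. s i - s j))"
        using ki \<open>i \<le> n\<close> \<open>k < n\<close> by (simp only: prod_int_remove prod_int_overlap) simp
      \<comment> \<open>Here the form of \<open>c i\<close> matters: \<open>a i * b i\<close>
        cancels the denominators that depend on \<open>i\<close>, and \<open>m i\<close> fills the
        gap in the product of the \<open>m j\<close>.\<close>
      also have "\<dots> = b n * a k * (m i * (\<Prod>j\<in>{k..n} - {i}. m j))
          * ((\<Prod>j\<in>{k + 1..n - 1}. s i - s j + c j) / (\<Prod>j\<in>{k..n} - {i}. s i - s j))"
        using assms(1)[of i] assms(2)[of i] by (simp add: c_def)
      also have "m i * (\<Prod>j\<in>{k..n} - {i}. m j) = (\<Prod>j\<in>{k..n}. m j)"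
        using i by (simp add: prod.remove)
      also have "(\<Prod>j\<in>{k + 1..n - 1}. s i - s j + c j) = poly p (s i)"
        by (simp add: p_def poly_prod algebra_simps)
      finally show ?thesis .
    qed
    then have "(\<Sum>i\<in>{k..n}. F n i * G i k) = b n * a k * (\<Prod>j\<in>{k..n}. m j)
        * (\<Sum>i\<in>{k..n}. poly p (s i) / (\<Prod>j\<in>{k..n} - {i}. s i - s j))"
      by (simp add: sum_distrib_left)
    also have "\<dots> = 0"
    proof -
      \<comment> \<open>The left side is \<open>n - k\<close> and the right side
        \<open>n - k + 1\<close>, so the bound holds with nothing to spare.\<close>
      have "degree p + 1 < card {k..n}"
        using that by (simp add: deg)
      with \<open>inj s\<close> show ?thesis
        by (simp add: divided_difference_eq_0 inj_on_subset)
    qed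
    finally show ?thesis .
  qed
  \<comment> \<open>On the diagonal one term remains and its products are empty; for
    \<open>n < k\<close> the sum itself is empty.\<close>
  have "(\<Sum>i\<in>{k..n}. F n i * G i k) = (if n = k then 1 else 0)" for n k
  proof (cases n k rule: linorder_cases)
    case equal
    then show ?thesis
      using assms(1,2) by (simp add: F G)
  qed (simp_all add: off_diag)
  with assms(4,6) show ?thesis
    by (simp add: matrix_inversion_def lower_triangular_def)
qed

end
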